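(* Let $W:\mathbb{R}^d\to\mathcal{M}_n(\mathbb{C})$ be any matrix weight (not necessarily a matrix $A_2$ weight) with $W^{-1}$ locally integrable, and let $\mathscr{D}$ be a dyadic grid. Then the maximal function $$M_W'\vec f(x)=\sup_{\mathscr{D}\ni I\ni x}\frac1{|I|}\int_I\big|(m_I(W^{-1}))^{-1/2}W^{-1/2}(y)\vec f(y)\big|\,dy$$ is of weak type $(2,2)$: there is $C<\infty$ such that for all $\vec f\in L^2(\mathbb{R}^d;\mathbb{C}^n)$ and all $\lambda>0$, $$|\{x\in\mathbb{R}^d: M_W'\vec f(x)>\lambda\}|\le\frac{C}{\lambda^2}\|\vec f\|_{L^2}^2 .$$
   Context: $n,d\ge1$ are integers; $\mathcal{M}_n(\mathbb{C})$ is the algebra of $n\times n$ complex matrices; $|\cdot|$ is the Euclidean norm on $\mathbb{C}^n$ (and Lebesgue measure of sets). A matrix weight is a measurable $W:\mathbb{R}^d\to\mathcal{M}_n(\mathbb{C})$ that is positive definite a.e. $m_I(W^{-1})$ is the entrywise average of $W^{-1}$ over $I$. A dyadic grid is a nested family of half-open cubes (sides parallel to the axes) of side lengths $2^k$, $k\in\mathbb{Z}$, such that for each $k$ the cubes of side length $2^k$ partition $\mathbb{R}^d$. *)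

theory Defs
  imports "HOL-Analysis.Analysis"
begin

definition conj_transpose :: "complex ^ 'n ^ 'm \<Rightarrow> complex ^ 'm ^ 'n" where
  "conj_transpose A = (\<chi> i j. cnj (A $ j $ i))"

definition hermitian :: "complex ^ 'n ^ 'n \<Rightarrow> bool" where
  "hermitian A \<longleftrightarrow> conj_transpose A = A"

definition quad_form :: "complex ^ 'n ^ 'n \<Rightarrow> complex ^ 'n \<Rightarrow> complex" where
  "quad_form A x = (\<Sum>i\<in>UNIV. cnj (x $ i) * (A *v x) $ i)"

text \<open>The quadratic form of a Hermitian matrix is real-valued, so its real part is its value.\<close>

definition pos_def :: "complex ^ 'n ^ 'n \<Rightarrow> bool" where
  "pos_def A \<longleftrightarrow> hermitian A \<and> (\<forall>x. x \<noteq> 0 \<longrightarrow> 0 < Re (quad_form A x))"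

definition pos_semidef :: "complex ^ 'n ^ 'n \<Rightarrow> bool" where
  "pos_semidef A \<longleftrightarrow> hermitian A \<and> (\<forall>x. 0 \<le> Re (quad_form A x))"

text \<open>The unique positive semidefinite square root; meaningful for positive semidefinite
  \<open>A\<close> only.\<close>

definition mat_sqrt :: "complex ^ 'n ^ 'n \<Rightarrow> complex ^ 'n ^ 'n" where
  "mat_sqrt A = (THE B. pos_semidef B \<and> B ** B = A)"

text \<open>\<open>A\<^sup>-\<^sup>1\<^sup>/\<^sup>2\<close>, for positive definite \<open>A\<close>.\<close>

definition mat_inv_sqrt :: "complex ^ 'n ^ 'n \<Rightarrow> complex ^ 'n ^ 'n" where
  "mat_inv_sqrt A = mat_sqrt (matrix_inv A)"

definition matrix_weight :: "(real ^ 'd \<Rightarrow> complex ^ 'n ^ 'n) \<Rightarrow> bool" where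
  "matrix_weight W \<longleftrightarrow> W \<in> borel_measurable lebesgue \<and> (AE x in lebesgue. pos_def (W x))"

definition locally_integrable_matrix :: "(real ^ 'd \<Rightarrow> complex ^ 'n ^ 'n) \<Rightarrow> bool" where
  "locally_integrable_matrix F \<longleftrightarrow>
     (\<forall>K. compact K \<longrightarrow> (\<forall>i j. set_integrable lebesgue K (\<lambda>x. F x $ i $ j)))"

definition matrix_average :: "(real ^ 'd) set \<Rightarrow> (real ^ 'd \<Rightarrow> complex ^ 'n ^ 'n) \<Rightarrow> complex ^ 'n ^ 'n"
  where
  "matrix_average I F =
     (\<chi> i j. (LINT y:I|lebesgue. F y $ i $ j) / complex_of_real (measure lebesgue I))"

definition half_open_cube :: "real ^ 'd \<Rightarrow> real \<Rightarrow> (real ^ 'd) set" where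
  "half_open_cube a s = {x. \<forall>i. a $ i \<le> x $ i \<and> x $ i < a $ i + s}"

definition dyadic_grid :: "(real ^ 'd) set set \<Rightarrow> bool" where
  "dyadic_grid D \<longleftrightarrow>
     (\<forall>Q\<in>D. \<exists>a. \<exists>k::int. Q = half_open_cube a (2 powi k)) \<and>
     (\<forall>P\<in>D. \<forall>Q\<in>D. P \<inter> Q = {} \<or> P \<subseteq> Q \<or> Q \<subseteq> P) \<and>
     (\<forall>k::int. partition_on UNIV {Q\<in>D. \<exists>a. Q = half_open_cube a (2 powi k)})"

text \<open>The averages are taken in \<open>[0, \<infinity>]\<close>, so the maximal function may take the value \<open>\<infinity>\<close>.\<close>

definition maximal_fun ::
  "(real ^ 'd) set set \<Rightarrow> (real ^ 'd \<Rightarrow> complex ^ 'n ^ 'n) \<Rightarrow> (real ^ 'd \<Rightarrow> complex ^ 'n)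
     \<Rightarrow> real ^ 'd \<Rightarrow> ennreal" where
  "maximal_fun D W f x =
     (SUP I\<in>{I\<in>D. x \<in> I}.
        (\<integral>\<^sup>+y\<in>I. ennreal (norm ((mat_inv_sqrt (matrix_average I (\<lambda>z. matrix_inv (W z)))
            ** mat_inv_sqrt (W y)) *v f y)) \<partial>lebesgue)
        / emeasure lebesgue I)"

definition in_L2 :: "(real ^ 'd \<Rightarrow> complex ^ 'n) \<Rightarrow> bool" where
  "in_L2 f \<longleftrightarrow> f \<in> borel_measurable lebesgue \<and> integrable lebesgue (\<lambda>x. (norm (f x))\<^sup>2)"

definition L2_norm_fun :: "(real ^ 'd \<Rightarrow> complex ^ 'n) \<Rightarrow> real" where
  "L2_norm_fun f = sqrt (LINT x|lebesgue. (norm (f x))\<^sup>2)"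

end

theory Submission
  imports Defs
begin

text \<open>The estimate holds with \<open>C = CARD('n)\<close>, because the matrix maximal function is controlled by the scalar
  dyadic maximal function of \<open>|f|\<^sup>2\<close>. Let \<open>m\<close> be the average of \<open>W\<^sup>-\<^sup>1\<close> over a cube \<open>I\<close> and \<open>V = m\<^sup>-\<^sup>1\<^sup>/\<^sup>2\<close>. The
  operator norm of \<open>V W\<^sup>-\<^sup>1\<^sup>/\<^sup>2\<close> is at most its Hilbert--Schmidt norm, whose square is
  \<open>trace (V W\<^sup>-\<^sup>1 V)\<close>. This is linear in \<open>W\<^sup>-\<^sup>1\<close>, so its average over \<open>I\<close> is \<open>trace (V m V)\<close>, the trace of
  the identity. Hence the average of \<open>|V W\<^sup>-\<^sup>1\<^sup>/\<^sup>2 f|\<close> exceeds \<open>l\<close> only if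
  \<open>|I| \<le> CARD('n) / l\<^sup>2 \<integral>\<^sub>I |f|\<^sup>2\<close> (\<open>emeasure_le_of_average_gt\<close>). The set where the maximal function exceeds \<open>l\<close>
  is the union of these cubes. As the cubes are nested and countably many, the union inherits the bound
  with the integral over the whole space (\<open>emeasure_Union_nested_le\<close>).

  That \<open>W\<^sup>-\<^sup>1\<^sup>/\<^sup>2\<close> and \<open>m\<^sup>-\<^sup>1\<^sup>/\<^sup>2\<close> really are Hermitian square roots of the inverses rests on existence and
  uniqueness of positive semidefinite square roots. Both follow from the spectral theorem in the form
  that the eigenvectors of a self-adjoint map span the space (\<open>selfadjoint_eigenvectors_span\<close>).\<close>

section \<open>Square roots of positive self-adjoint maps\<close>

text \<open>A maximiser \<open>v\<close> of the Rayleigh quotient over the unit sphere of \<open>S\<close> is an eigenvector: with \<open>c\<close> the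
  maximum, the form \<open>g x = c * (x \<bullet> x) - x \<bullet> T x\<close> is nonnegative on \<open>S\<close> and vanishes at \<open>v\<close>, so its
  derivative at \<open>v\<close> vanishes in every direction of \<open>S\<close>, in particular in the direction
  \<open>w = c *\<^sub>R v - T v\<close>, where it equals \<open>2 * (w \<bullet> w)\<close>.\<close>
lemma selfadjoint_eigenvector_in_subspace:
  fixes T :: "'a::euclidean_space \<Rightarrow> 'a"
  assumes lin: "linear T" and adj: "\<And>x y. T x \<bullet> y = x \<bullet> T y"
    and S: "subspace S" "T ` S \<subseteq> S" "S \<noteq> {0}"
  obtains v c where "v \<in> S" "v \<noteq> 0" "T v = c *\<^sub>R v"
proof -
  let ?K = "S \<inter> sphere 0 1"
  obtain u where u: "u \<in> S" "u \<noteq> 0"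
    using S(1,3) subspace_0 by blast
  have "u /\<^sub>R norm u \<in> ?K"
    using u S(1) by (simp add: subspace_scale)
  moreover have "compact ?K"
    using closed_Int_compact[OF closed_subspace[OF S(1)] compact_sphere] .
  moreover have "continuous_on ?K (\<lambda>x. x \<bullet> T x)"
    using lin by (intro continuous_intros linear_continuous_on) (simp add: linear_conv_bounded_linear)
  ultimately obtain v where v: "v \<in> ?K" and vmax: "\<And>x. x \<in> ?K \<Longrightarrow> x \<bullet> T x \<le> v \<bullet> T v"
    using continuous_attains_sup[of ?K] by blast
  define c where "c = v \<bullet> T v"
  define g where "g x = c * (x \<bullet> x) - x \<bullet> T x" for x
  have vS: "v \<in> S" and vv: "v \<bullet> v = 1"
    using v by (auto simp: norm_eq_1)
  have g_nonneg: "0 \<le> g x" if "x \<in> S" for x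
  proof (cases "x = 0")
    case False
    have "(x /\<^sub>R norm x) \<bullet> T (x /\<^sub>R norm x) \<le> c"
      unfolding c_def using that False S(1) by (intro vmax) (simp add: subspace_scale)
    also have "(x /\<^sub>R norm x) \<bullet> T (x /\<^sub>R norm x) = (x \<bullet> T x) / (norm x)\<^sup>2"
      using lin by (simp add: linear_scale power2_eq_square divide_simps)
    finally show ?thesis
      using False by (simp add: g_def divide_simps dot_square_norm)
  qed (simp add: g_def)
  define w where "w = c *\<^sub>R v - T v"
  have wS: "w \<in> S"
    unfolding w_def using vS S by (meson image_subset_iff subspace_diff subspace_scale)
  have expand: "g (v + t *\<^sub>R w) = 2 * t * (w \<bullet> w) + t\<^sup>2 * g w" for t
  proof -
    have "T (v + t *\<^sub>R w) = T v + t *\<^sub>R T w"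
      using lin by (simp add: linear_add linear_scale)
    moreover have "v \<bullet> T w = T v \<bullet> w"
      by (simp add: adj)
    moreover have "w \<bullet> T v = T v \<bullet> w" "w \<bullet> v = v \<bullet> w"
      by (simp_all add: inner_commute)
    ultimately have "g (v + t *\<^sub>R w) = 2 * t * (c * (v \<bullet> w) - T v \<bullet> w) + t\<^sup>2 * g w"
      using vv unfolding g_def
      by (simp add: inner_add_left inner_add_right c_def[symmetric] power2_eq_square algebra_simps)
    moreover have "c * (v \<bullet> w) - T v \<bullet> w = w \<bullet> w"
      by (simp add: w_def inner_diff_left)
    ultimately show ?thesis by simp
  qed
  have "w \<bullet> w = 0"
  proof (rule ccontr)
    assume "w \<bullet> w \<noteq> 0"
    then have pos: "0 < w \<bullet> w" by simp
    \<comment> \<open>A negative \<open>t\<close> so small that the quadratic term of \<open>g (v + t *\<^sub>R w)\<close> cannot compensate the linear one.\<close>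
    define t where "t = - (w \<bullet> w) / (g w + 1)"
    have gw: "0 \<le> g w" using g_nonneg wS by simp
    have t0: "t < 0" using pos gw by (simp add: t_def divide_simps)
    have "0 \<le> g (v + t *\<^sub>R w)"
      using vS wS S(1) by (intro g_nonneg) (simp add: subspace_add subspace_scale)
    then have "0 \<le> t * (2 * (w \<bullet> w) + t * g w)"
      by (simp add: expand power2_eq_square algebra_simps)
    then have "2 * (w \<bullet> w) + t * g w \<le> 0"
      using t0 by (simp add: zero_le_mult_iff)
    moreover have "t * g w \<ge> - (w \<bullet> w)"
    proof -
      have "(w \<bullet> w) * g w \<le> (w \<bullet> w) * (g w + 1)" using pos by simp
      then show ?thesis using gw by (simp add: t_def divide_simps)
    qed
    ultimately show False using pos by simp
  qed
  then have "T v = c *\<^sub>R v" by (simp add: w_def)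
  then show thesis using that vS vv by force
qed

text \<open>The orthogonal complement of the span of all eigenvectors is invariant under \<open>T\<close>, so if it were nonzero
  it would contain an eigenvector, which would then be orthogonal to itself.\<close>
lemma selfadjoint_eigenvectors_span:
  fixes T :: "'a::euclidean_space \<Rightarrow> 'a"
  assumes lin: "linear T" and adj: "\<And>x y. T x \<bullet> y = x \<bullet> T y"
  shows "span {v. \<exists>c. T v = c *\<^sub>R v} = UNIV"
proof (rule ccontr)
  let ?E = "{v. \<exists>c. T v = c *\<^sub>R v}"
  let ?S = "{x. \<forall>e\<in>span ?E. x \<bullet> e = 0}"
  assume neq: "span ?E \<noteq> UNIV"
  obtain y where y: "y \<notin> span ?E" using neq by blast
  obtain p z where pz: "p \<in> span ?E" "\<And>e. e \<in> span ?E \<Longrightarrow> orthogonal z e" "y = p + z"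
    using orthogonal_subspace_decomp_exists[of ?E y] by blast
  have "z \<in> ?S" "z \<noteq> 0"
    using pz y by (auto simp: orthogonal_def)
  then have "?S \<noteq> {0}" by blast
  moreover have "subspace ?S"
    by (auto simp: subspace_def inner_add_left)
  moreover have "T ` ?S \<subseteq> ?S"
  proof safe
    fix x e assume x: "\<forall>e\<in>span ?E. x \<bullet> e = 0" and e: "e \<in> span ?E"
    from e show "T x \<bullet> e = 0"
    proof (induction rule: span_induct_alt)
      case (step a b d)
      then show ?case using x
        by (auto simp: inner_add_right adj span_base)
    qed simp
  qed
  ultimately obtain v c where "v \<in> ?S" "v \<noteq> 0" "T v = c *\<^sub>R v"
    using selfadjoint_eigenvector_in_subspace[OF lin adj, of ?S] by blast
  then have "v \<bullet> v = 0" using span_base[of v ?E] by blast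
  with \<open>v \<noteq> 0\<close> show False by simp
qed

text \<open>Rescaling each vector of an eigenbasis by the fourth root of its eigenvalue gives \<open>Q\<close>. The basis need
  not be orthogonal: eigenvectors for different eigenvalues are orthogonal anyway, and on those with the
  same eigenvalue \<open>Q\<close> is a scalar. The fourth root, rather than the square root, makes positivity of the
  square root \<open>R = Q \<circ> Q\<close> immediate, since \<open>x \<bullet> R x = Q x \<bullet> Q x\<close>.\<close>
lemma positive_selfadjoint_fourth_root:
  fixes T :: "'a::euclidean_space \<Rightarrow> 'a"
  assumes lin: "linear T" and adj: "\<And>x y. T x \<bullet> y = x \<bullet> T y" and pos: "\<And>x. 0 \<le> x \<bullet> T x"
  obtains Q where "linear Q" "\<And>x y. Q x \<bullet> y = x \<bullet> Q y" "\<And>x. Q (Q (Q (Q x))) = T x"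
proof -
  obtain B where B: "B \<subseteq> {v. \<exists>c. T v = c *\<^sub>R v}" "independent B"
      "{v. \<exists>c. T v = c *\<^sub>R v} \<subseteq> span B"
    using maximal_independent_subset[of "{v. \<exists>c. T v = c *\<^sub>R v}"] by blast
  then have spanB: "span B = UNIV"
    using selfadjoint_eigenvectors_span[OF lin adj] by (metis UNIV_eq_I UNIV_I span_mono span_span subsetD)
  have "\<forall>b\<in>B. \<exists>c. T b = c *\<^sub>R b" using B(1) by blast
  then obtain c where c: "\<And>b. b \<in> B \<Longrightarrow> T b = c b *\<^sub>R b" by metis
  have c_nonneg: "0 \<le> c b" if "b \<in> B" for b
  proof -
    have "b \<noteq> 0" using that B(2) dependent_zero by blast
    moreover have "0 \<le> c b * (b \<bullet> b)" using pos[of b] c[OF that] by simp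
    ultimately show ?thesis by (metis inner_gt_zero_iff mult_less_0_iff not_less)
  qed
  define g where "g x = sqrt (sqrt x)" for x
  obtain Q where Q: "linear Q" "\<And>b. b \<in> B \<Longrightarrow> Q b = g (c b) *\<^sub>R b"
    using linear_independent_extend[OF B(2), of "\<lambda>b. g (c b) *\<^sub>R b"] by blast
  have "Q x \<bullet> y = x \<bullet> Q y" for x y
  proof -
    have base: "Q a \<bullet> b = a \<bullet> Q b" if "a \<in> B" "b \<in> B" for a b
    proof (cases "c a = c b")
      case False
      have "c a * (a \<bullet> b) = c b * (a \<bullet> b)"
        using adj[of a b] c that by simp
      then show ?thesis using False Q that by simp
    qed (use Q that in simp)
    have "Q a \<bullet> y = a \<bullet> Q y" if "a \<in> B" for a
    proof -
      have "y \<in> span B" by (simp add: spanB)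
      then show ?thesis
      proof (induction rule: span_induct_alt)
        case base then show ?case using Q(1) by (simp add: linear_0)
      next
        case (step k b d)
        then show ?case using base[OF that step(1)] Q(1)
          by (simp add: linear_add linear_scale inner_add_right)
      qed
    qed
    note half = this
    have "x \<in> span B" by (simp add: spanB)
    then show ?thesis
    proof (induction rule: span_induct_alt)
      case base then show ?case using Q(1) by (simp add: linear_0)
    next
      case (step k b d)
      then show ?case using half[OF step(1)] Q(1)
        by (simp add: linear_add linear_scale inner_add_left)
    qed
  qed
  moreover have "Q (Q (Q (Q x))) = T x" for x
  proof -
    have "(\<lambda>x. Q (Q (Q (Q x)))) x = T x"
    proof (rule linear_eq_on_span[where B = B and f = "\<lambda>x. Q (Q (Q (Q x)))" and g = T])
      show "linear (\<lambda>x. Q (Q (Q (Q x))))"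
        using linear_compose[OF linear_compose[OF Q(1) Q(1)] linear_compose[OF Q(1) Q(1)]]
        by (simp add: o_def)
      show "Q (Q (Q (Q b))) = T b" if "b \<in> B" for b
      proof -
        have "g (c b) * (g (c b) * (g (c b) * g (c b))) = c b"
          using c_nonneg[OF that] unfolding g_def
          by (metis mult.assoc real_sqrt_ge_zero real_sqrt_mult_self abs_of_nonneg)
        then show ?thesis using Q c that by (simp add: linear_scale)
      qed
    qed (use lin spanB in auto)
    then show ?thesis by simp
  qed
  ultimately show thesis using that Q(1) by blast
qed

text \<open>Eigenvectors of the square span the space, so a positive square root is determined everywhere. From
  \<open>(R + sqrt c) (R - sqrt c) v = 0\<close>, the vector \<open>w = R v - sqrt c *\<^sub>R v\<close> satisfies \<open>R w = - sqrt c *\<^sub>R w\<close>,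
  which for \<open>c > 0\<close> contradicts positivity of \<open>R\<close> unless \<open>w = 0\<close>; for \<open>c = 0\<close> one has
  \<open>R v \<bullet> R v = v \<bullet> R (R v) = 0\<close>.\<close>
lemma positive_square_root_on_eigenvector:
  fixes R :: "'a::euclidean_space \<Rightarrow> 'a"
  assumes lin: "linear R" and adj: "\<And>x y. R x \<bullet> y = x \<bullet> R y" and pos: "\<And>x. 0 \<le> x \<bullet> R x"
    and v: "R (R v) = c *\<^sub>R v"
  shows "R v = sqrt c *\<^sub>R v"
proof (cases "v = 0")
  case False
  have norm_Rv: "R v \<bullet> R v = c * (v \<bullet> v)" using v by (simp add: adj)
  then have c: "0 \<le> c" 
    using False by (metis inner_gt_zero_iff inner_ge_zero zero_le_mult_iff not_less)
  define w where "w = R v - sqrt c *\<^sub>R v"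
  have Rw: "R w = - (sqrt c *\<^sub>R w)"
    using lin c v unfolding w_def
    by (simp add: linear_diff linear_scale algebra_simps)
  have "w = 0"
  proof (cases "c = 0")
    case True
    then show ?thesis using norm_Rv by (simp add: w_def)
  next
    case False
    have "0 \<le> - (sqrt c * (w \<bullet> w))" using pos[of w] Rw by simp
    moreover have "0 < sqrt c" using c False by simp
    ultimately show ?thesis
      by (metis inner_gt_zero_iff mult_pos_pos neg_0_le_iff_le not_less)
  qed
  then show ?thesis by (simp add: w_def)
qed (use lin in \<open>simp add: linear_0\<close>)

section \<open>Positive definite complex matrices\<close>
lemma linear_complex_matrix: "linear ((*v) (A :: complex ^ 'n ^ 'm))"
  by (rule linearI)
     (simp_all add: vec_eq_iff matrix_vector_mult_def scaleR_sum_right distrib_left sum.distrib)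

text \<open>The inner product of the real Euclidean space \<open>complex ^ 'n\<close> is the real part of the Hermitian one. It
  carries the results on real self-adjoint maps over to Hermitian matrices.\<close>
lemma Re_quad_form: "Re (quad_form A x) = x \<bullet> (A *v x)"
  by (simp add: quad_form_def inner_vec_def inner_complex_def algebra_simps)

text \<open>Real self-adjointness recovers the complex entries because it is tested on \<open>axis j z\<close> both for \<open>z = 1\<close>
  and for \<open>z = \<i>\<close>.\<close>
lemma hermitian_iff_selfadjoint:
  fixes A :: "complex ^ 'n ^ 'n"
  shows "hermitian A \<longleftrightarrow> (\<forall>x y. (A *v x) \<bullet> y = x \<bullet> (A *v y))"
proof
  assume "hermitian A"
  then have A: "A $ i $ j = cnj (A $ j $ i)" for i j
    by (metis (lifting) conj_transpose_def hermitian_def vec_lambda_beta)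
  have inner: "u \<bullet> w = Re (\<Sum>i\<in>UNIV. cnj (u $ i) * w $ i)" for u w :: "complex ^ 'n"
    by (simp add: inner_vec_def inner_complex_def algebra_simps)
  show "\<forall>x y. (A *v x) \<bullet> y = x \<bullet> (A *v y)"
  proof safe
    fix x y
    have "(\<Sum>i\<in>UNIV. cnj ((A *v x) $ i) * y $ i)
        = (\<Sum>i\<in>UNIV. \<Sum>j\<in>UNIV. cnj (A $ i $ j) * cnj (x $ j) * y $ i)"
      by (simp add: matrix_vector_mult_def sum_distrib_right)
    also have "\<dots> = (\<Sum>j\<in>UNIV. \<Sum>i\<in>UNIV. A $ j $ i * cnj (x $ j) * y $ i)"
      by (subst sum.swap) (simp flip: A)
    also have "\<dots> = (\<Sum>j\<in>UNIV. cnj (x $ j) * (A *v y) $ j)"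
      by (simp add: matrix_vector_mult_def sum_distrib_left mult_ac)
    finally show "(A *v x) \<bullet> y = x \<bullet> (A *v y)"
      by (simp only: inner)
  qed
next
  assume adj: "\<forall>x y. (A *v x) \<bullet> y = x \<bullet> (A *v y)"
  have entry: "(A *v axis k z) $ m = A $ m $ k * z" for k m z
    by (simp add: matrix_vector_mult_def axis_def if_distrib[of "\<lambda>u. _ * u"] cong: if_cong)
  have "cnj (A $ j $ i) = A $ i $ j" for i j
  proof -
    have eq: "(A $ j $ i) \<bullet> z = 1 \<bullet> (A $ i $ j * z)" for z
      using adj[rule_format, of "axis i 1" "axis j z"] by (simp add: inner_axis inner_axis' entry)
    show ?thesis
      using eq[of 1] eq[of \<i>] by (simp add: inner_complex_def complex_eq_iff)
  qed
  then show "hermitian A"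
    by (simp add: hermitian_def conj_transpose_def vec_eq_iff)
qed

lemma pos_semidef_iff:
  "pos_semidef A \<longleftrightarrow> (\<forall>x y. (A *v x) \<bullet> y = x \<bullet> (A *v y)) \<and> (\<forall>x. 0 \<le> x \<bullet> (A *v x))"
  by (simp add: pos_semidef_def hermitian_iff_selfadjoint Re_quad_form)

lemma pos_def_iff:
  "pos_def A \<longleftrightarrow> (\<forall>x y. (A *v x) \<bullet> y = x \<bullet> (A *v y)) \<and> (\<forall>x. x \<noteq> 0 \<longrightarrow> 0 < x \<bullet> (A *v x))"
  by (simp add: pos_def_def hermitian_iff_selfadjoint Re_quad_form)

lemma pos_def_imp_pos_semidef: "pos_def A \<Longrightarrow> pos_semidef A"
  unfolding pos_def_iff pos_semidef_iff by (metis inner_zero_left order_less_imp_le order_refl)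

lemma complex_scale_decompose:
  fixes x :: "complex ^ 'n"
  shows "c *s x = Re c *\<^sub>R x + Im c *\<^sub>R (\<i> *s x)"
  by (simp add: vec_eq_iff complex_eq_iff)

text \<open>Commuting with multiplication by \<open>\<i>\<close> is what separates the maps given by complex matrices from the
  other real-linear ones.\<close>
lemma complex_linear_imp_matrix:
  fixes R :: "complex ^ 'n \<Rightarrow> complex ^ 'm"
  assumes R: "linear R" and imag: "\<And>x. R (\<i> *s x) = \<i> *s R x"
  obtains B where "\<And>x. B *v x = R x"
proof -
  have "Vector_Spaces.linear (*s) (*s) R"
  proof (intro Vector_Spaces.linear.intro module_hom.intro module_hom_axioms.intro)
    show "R (c *s x) = c *s R x" for c x
      using R imag by (simp add: complex_scale_decompose[of c] linear_add linear_scale)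
    show "R (x + y) = R x + R y" for x y
      using R by (simp add: linear_add)
  qed (unfold_locales)
  from matrix_works[OF this] that show thesis by blast
qed

lemma pos_semidef_sqrt_unique:
  assumes B: "pos_semidef B" "B ** B = A" and C: "pos_semidef C" "C ** C = A"
  shows "B = C"
proof -
  have A: "\<forall>x y. (A *v x) \<bullet> y = x \<bullet> (A *v y)"
    using B by (metis matrix_vector_mul_assoc pos_semidef_iff)
  have "B *v x = C *v x" for x
  proof (rule linear_eq_on_span[where B = "{v. \<exists>c. A *v v = c *\<^sub>R v}"
          and f = "(*v) B" and g = "(*v) C"])
    show "x \<in> span {v. \<exists>c. A *v v = c *\<^sub>R v}"
      using selfadjoint_eigenvectors_span[OF linear_complex_matrix] A by blast
    show "B *v v = C *v v" if v: "v \<in> {v. \<exists>c. A *v v = c *\<^sub>R v}" for v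
    proof -
      obtain c where c: "A *v v = c *\<^sub>R v" using v by blast
      have "M *v v = sqrt c *\<^sub>R v" if "pos_semidef M" "M ** M = A" for M
        using that c unfolding pos_semidef_iff
        by (intro positive_square_root_on_eigenvector linear_complex_matrix)
           (auto simp: matrix_vector_mul_assoc)
      then show ?thesis using B C by simp
    qed
  qed (rule linear_complex_matrix)+
  then show ?thesis by (simp add: matrix_eq)
qed

text \<open>The square of the fourth root is a priori only real-linear, as it is built from a basis over the reals. It acts as
  \<open>sqrt c\<close> on the whole eigenspace of \<open>c\<close>, and eigenspaces of \<open>A\<close> are closed under multiplication by \<open>\<i>\<close>;
  so it commutes with \<open>\<i>\<close> and is given by a complex matrix.\<close>
lemma pos_semidef_sqrt_exists:
  fixes A :: "complex ^ 'n ^ 'n"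
  assumes "pos_semidef A"
  obtains B where "pos_semidef B" "B ** B = A"
proof -
  have adj: "(A *v x) \<bullet> y = x \<bullet> (A *v y)" and pos: "0 \<le> x \<bullet> (A *v x)" for x y
    using assms by (auto simp: pos_semidef_iff)
  obtain Q where Q: "linear Q" "\<And>x y. Q x \<bullet> y = x \<bullet> Q y" "\<And>x. Q (Q (Q (Q x))) = A *v x"
    using positive_selfadjoint_fourth_root[OF linear_complex_matrix adj pos] by metis
  define R where "R x = Q (Q x)" for x
  have R: "linear R" "R x \<bullet> y = x \<bullet> R y" "0 \<le> x \<bullet> R x" "R (R x) = A *v x" for x y
  proof -
    show "linear R"
      using linear_compose[OF Q(1) Q(1)] by (simp add: R_def[abs_def] o_def)
    show "0 \<le> x \<bullet> R x"
      by (metis R_def Q(2) inner_ge_zero)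
  qed (simp_all add: R_def Q(2,3))
  let ?E = "{v. \<exists>c. A *v v = c *\<^sub>R v}"
  have linI: "linear (\<lambda>x :: complex ^ 'n. \<i> *s x)"
    by (rule linearI) (simp_all add: vec_eq_iff algebra_simps)
  have "R (\<i> *s x) = \<i> *s R x" for x
  proof -
    have "(R \<circ> (*s) \<i>) x = ((*s) \<i> \<circ> R) x"
    proof (rule linear_eq_on_span[where B = ?E and f = "R \<circ> (*s) \<i>" and g = "(*s) \<i> \<circ> R"])
      show "linear (R \<circ> (*s) \<i>)" "linear ((*s) \<i> \<circ> R)"
        using linI R(1) by (auto intro: linear_compose)
      show "x \<in> span ?E"
        using selfadjoint_eigenvectors_span[OF linear_complex_matrix adj] by blast
      show "(R \<circ> (*s) \<i>) v = ((*s) \<i> \<circ> R) v" if v: "v \<in> ?E" for v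
      proof -
        obtain c where c: "A *v v = c *\<^sub>R v" using v by blast
        have "A *v (\<i> *s v) = \<i> *s (A *v v)"
          by (simp add: vec.scale)
        then have ic: "A *v (\<i> *s v) = c *\<^sub>R (\<i> *s v)"
          using c linI by (simp add: linear_scale)
        have "R u = sqrt c *\<^sub>R u" if "A *v u = c *\<^sub>R u" for u
          using that R by (intro positive_square_root_on_eigenvector) auto
        then show ?thesis
          using c ic linI by (simp add: linear_scale)
      qed
    qed
    then show ?thesis by simp
  qed
  then obtain B where B: "\<And>x. B *v x = R x"
    using complex_linear_imp_matrix[OF R(1)] by blast
  show thesis
  proof
    show "pos_semidef B" using R(2,3) by (simp add: pos_semidef_iff B)
    show "B ** B = A" by (simp add: matrix_eq B R(4) flip: matrix_vector_mul_assoc)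
  qed
qed

text \<open>Existence and uniqueness together make the definite description behind \<open>mat_sqrt\<close> meaningful.\<close>
lemma mat_sqrt_properties:
  assumes "pos_semidef A"
  shows "pos_semidef (mat_sqrt A)" and "mat_sqrt A ** mat_sqrt A = A"
proof -
  have "\<exists>!B. pos_semidef B \<and> B ** B = A"
    using pos_semidef_sqrt_exists[OF assms] pos_semidef_sqrt_unique by metis
  from theI'[OF this] show "pos_semidef (mat_sqrt A)" "mat_sqrt A ** mat_sqrt A = A"
    unfolding mat_sqrt_def by blast+
qed

lemma pos_def_invertible:
  assumes "pos_def A" shows "invertible A"
proof -
  have "x = 0" if "A *v x = 0" for x
    using assms that unfolding pos_def_iff by (metis inner_zero_right less_irrefl)
  then show ?thesis
    by (simp add: invertible_left_inverse matrix_left_invertible_ker)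
qed

lemma invertible_matrix_inv:
  assumes "invertible A"
  shows "A ** matrix_inv A = mat 1" and "matrix_inv A ** A = mat 1"
  using someI_ex[OF assms[unfolded invertible_def]] by (simp_all add: matrix_inv_def)

lemma pos_def_matrix_inv:
  assumes "pos_def A" shows "pos_def (matrix_inv A)"
proof -
  have A: "matrix_inv A *v (A *v x) = x" "A *v (matrix_inv A *v x) = x" for x
    using invertible_matrix_inv[OF pos_def_invertible[OF assms]]
    by (simp_all add: matrix_vector_mul_assoc)
  show ?thesis
    using assms A unfolding pos_def_iff by (metis matrix_vector_mult_0_right)
qed

section \<open>Traces and averages of matrix functions\<close>

text \<open>The norm on the type of matrices is the Hilbert--Schmidt norm, which dominates the operator norm by
  Cauchy--Schwarz in each row.\<close>
lemma norm_matrix_vector_mult_le: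
  fixes M :: "complex ^ 'n ^ 'm"
  shows "norm (M *v v) \<le> norm M * norm v"
proof -
  have row: "norm ((M *v v) $ i) \<le> norm (M $ i) * norm v" for i
  proof -
    have "norm ((M *v v) $ i) \<le> (\<Sum>j\<in>UNIV. norm (M $ i $ j) * norm (v $ j))"
      unfolding matrix_vector_mult_def
      by (simp flip: norm_mult) (rule norm_sum)
    also have "\<dots> \<le> norm (M $ i) * norm v"
      using L2_set_mult_ineq[of "\<lambda>j. norm (M $ i $ j)" "\<lambda>j. norm (v $ j)" UNIV]
      by (simp add: norm_vec_def)
    finally show ?thesis .
  qed
  have "norm (M *v v) \<le> L2_set (\<lambda>i. norm (M $ i) * norm v) UNIV"
    unfolding norm_vec_def[of "M *v v"] by (intro L2_set_mono row) simp
  also have "\<dots> = norm M * norm v"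
    by (simp add: norm_vec_def[of M] L2_set_left_distrib)
  finally show ?thesis .
qed

lemma conj_transpose_mult: "conj_transpose (A ** B) = conj_transpose B ** conj_transpose A"
  by (simp add: conj_transpose_def matrix_matrix_mult_def vec_eq_iff mult.commute)

lemma norm_matrix_power2_eq_trace:
  fixes M :: "complex ^ 'n ^ 'n"
  shows "(norm M)\<^sup>2 = Re (trace (M ** conj_transpose M))"
  by (simp add: norm_vec_def L2_set_def sum_nonneg trace_def matrix_matrix_mult_def conj_transpose_def
      complex_mult_cnj cmod_power2)

text \<open>The right-hand side depends on \<open>S\<close> only through its square, linearly. For \<open>S = W\<^sup>-\<^sup>1\<^sup>/\<^sup>2 (y)\<close> it is therefore
  linear in \<open>W\<^sup>-\<^sup>1 (y)\<close>, and it can be averaged over a cube.\<close>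
lemma norm_hermitian_mult_power2_eq_trace:
  fixes V S :: "complex ^ 'n ^ 'n"
  assumes "hermitian V" "hermitian S"
  shows "(norm (V ** S))\<^sup>2 = Re (trace ((V ** V) ** (S ** S)))"
proof -
  have "conj_transpose (V ** S) = S ** V"
    using assms by (simp add: conj_transpose_mult hermitian_def)
  then have "(norm (V ** S))\<^sup>2 = Re (trace ((V ** S ** S) ** V))"
    by (simp add: norm_matrix_power2_eq_trace matrix_mul_assoc)
  also have "\<dots> = Re (trace (V ** (V ** S ** S)))"
    by (rule arg_cong[OF trace_mul_sym])
  finally show ?thesis by (simp add: matrix_mul_assoc)
qed

lemma set_integral_trace:
  fixes G :: "real ^ 'd \<Rightarrow> complex ^ 'n ^ 'n" and P :: "complex ^ 'n ^ 'n"
  assumes int: "\<And>i j. set_integrable lebesgue I (\<lambda>x. G x $ i $ j)" and I: "measure lebesgue I \<noteq> 0"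
  shows "set_integrable lebesgue I (\<lambda>x. trace (P ** G x))"
    and "(LINT x:I|lebesgue. trace (P ** G x))
           = complex_of_real (measure lebesgue I) * trace (P ** matrix_average I G)"
proof -
  have eq: "indicator I x *\<^sub>R trace (P ** G x)
      = (\<Sum>i\<in>UNIV. \<Sum>k\<in>UNIV. P $ i $ k * (indicator I x *\<^sub>R G x $ k $ i))" for x
    by (simp add: trace_def matrix_matrix_mult_def scaleR_sum_right)
  have ig: "integrable lebesgue (\<lambda>x. indicator I x *\<^sub>R G x $ i $ j)" for i j
    using int by (simp add: set_integrable_def)
  show "set_integrable lebesgue I (\<lambda>x. trace (P ** G x))"
    unfolding set_integrable_def eq
    by (intro Bochner_Integration.integrable_sum integrable_mult_right ig)
  have avg: "integral\<^sup>L lebesgue (\<lambda>x. indicator I x *\<^sub>R G x $ i $ j)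
      = complex_of_real (measure lebesgue I) * matrix_average I G $ i $ j" for i j
    using I by (simp add: matrix_average_def set_lebesgue_integral_def)
  have "(LINT x:I|lebesgue. trace (P ** G x))
      = (\<Sum>i\<in>UNIV. \<Sum>k\<in>UNIV. P $ i $ k
           * integral\<^sup>L lebesgue (\<lambda>x. indicator I x *\<^sub>R G x $ k $ i))"
    unfolding set_lebesgue_integral_def eq
    by (simp add: Bochner_Integration.integral_sum Bochner_Integration.integrable_sum
        integrable_mult_right ig del: mult_scaleR_right)
  also have "\<dots> = complex_of_real (measure lebesgue I) * trace (P ** matrix_average I G)"
    by (simp add: avg trace_def matrix_matrix_mult_def sum_distrib_left mult_ac)
  finally show "(LINT x:I|lebesgue. trace (P ** G x))
      = complex_of_real (measure lebesgue I) * trace (P ** matrix_average I G)" .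
qed

text \<open>The quadratic form is a trace against a rank-one matrix, so that integrating traces also integrates
  quadratic forms.\<close>
lemma quad_form_eq_trace: "quad_form A x = trace ((\<chi> i k. x $ i * cnj (x $ k)) ** A)"
proof -
  have "quad_form A x = (\<Sum>k\<in>UNIV. \<Sum>i\<in>UNIV. x $ i * cnj (x $ k) * A $ k $ i)"
    by (simp add: quad_form_def matrix_vector_mult_def sum_distrib_left mult_ac)
  also have "\<dots> = trace ((\<chi> i k. x $ i * cnj (x $ k)) ** A)"
    by (subst sum.swap) (simp add: trace_def matrix_matrix_mult_def)
  finally show ?thesis .
qed

text \<open>The quadratic form of the average is the average of the quadratic forms. It is positive, not merely
  nonnegative, because an almost everywhere positive function has positive integral over a set of
  positive measure.\<close>
lemma pos_def_matrix_average:
  fixes G :: "real ^ 'd \<Rightarrow> complex ^ 'n ^ 'n"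
  assumes int: "\<And>i j. set_integrable lebesgue I (\<lambda>x. G x $ i $ j)"
    and I: "0 < measure lebesgue I"
    and pos: "AE x in lebesgue. pos_def (G x)"
  shows "pos_def (matrix_average I G)"
  unfolding pos_def_def
proof (intro conjI allI impI)
  show "hermitian (matrix_average I G)"
  proof -
    have "(LINT y:I|lebesgue. G y $ i $ j) = cnj (LINT y:I|lebesgue. G y $ j $ i)" for i j
    proof -
      have "cnj (LINT y:I|lebesgue. G y $ j $ i)
          = integral\<^sup>L lebesgue (\<lambda>y. cnj (indicator I y *\<^sub>R G y $ j $ i))"
        unfolding set_lebesgue_integral_def by (rule Bochner_Integration.integral_cnj[symmetric])
      also have "\<dots> = integral\<^sup>L lebesgue (\<lambda>y. indicator I y *\<^sub>R G y $ i $ j)"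
      proof (rule integral_cong_AE)
        have ig: "integrable lebesgue (\<lambda>x. indicator I x *\<^sub>R G x $ i $ j)" for i j
          using int by (simp add: set_integrable_def)
        then show "(\<lambda>y. indicator I y *\<^sub>R G y $ i $ j) \<in> borel_measurable lebesgue"
          by (rule borel_measurable_integrable)
        show "(\<lambda>y. cnj (indicator I y *\<^sub>R G y $ j $ i)) \<in> borel_measurable lebesgue"
          using ig[of j i, THEN complex_integrable_cnj[THEN iffD2]]
          by (rule borel_measurable_integrable)
        show "AE y in lebesgue. cnj (indicator I y *\<^sub>R G y $ j $ i) = indicator I y *\<^sub>R G y $ i $ j"
          using pos
        proof eventually_elim
          case (elim y)
          then have "cnj (G y $ j $ i) = G y $ i $ j"
            unfolding pos_def_def hermitian_def conj_transpose_def
            by (metis (lifting) vec_lambda_beta)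
          then show ?case by simp
        qed
      qed
      finally show ?thesis by (simp add: set_lebesgue_integral_def)
    qed
    note entry = this
    have "cnj (matrix_average I G $ j $ i) = matrix_average I G $ i $ j" for i j
      using entry[of i j] by (simp add: matrix_average_def)
    then show ?thesis
      by (simp add: hermitian_def conj_transpose_def vec_eq_iff)
  qed
next
  fix v :: "complex ^ 'n"
  assume "v \<noteq> 0"
  define h where "h y = indicator I y * Re (quad_form (G y) v)" for y
  have h_eq: "h = (\<lambda>y. Re (indicator I y *\<^sub>R quad_form (G y) v))"
    by (simp add: h_def fun_eq_iff)
  have "set_integrable lebesgue I (\<lambda>y. quad_form (G y) v)"
    unfolding quad_form_eq_trace using int I by (intro set_integral_trace) auto
  then have int_q: "integrable lebesgue (\<lambda>y. indicator I y *\<^sub>R quad_form (G y) v)"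
    by (simp add: set_integrable_def)
  then have int_h: "integrable lebesgue h"
    unfolding h_eq by (rule integrable_Re)
  have "(LINT y:I|lebesgue. quad_form (G y) v)
      = complex_of_real (measure lebesgue I) * quad_form (matrix_average I G) v"
    unfolding quad_form_eq_trace using int I by (intro set_integral_trace) auto
  then have "integral\<^sup>L lebesgue h = measure lebesgue I * Re (quad_form (matrix_average I G) v)"
    unfolding h_eq by (subst Bochner_Integration.integral_Re[OF int_q]) (simp add: set_lebesgue_integral_def)
  moreover have "0 < integral\<^sup>L lebesgue h"
  proof -
    have nonneg: "AE y in lebesgue. 0 \<le> h y"
      using pos
    proof eventually_elim
      case (elim y)
      then show ?case using \<open>v \<noteq> 0\<close> by (simp add: h_def pos_def_def less_imp_le)
    qed
    have "integral\<^sup>L lebesgue h \<noteq> 0"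
    proof
      assume "integral\<^sup>L lebesgue h = 0"
      then have "AE y in lebesgue. h y = 0"
        using integral_nonneg_eq_0_iff_AE[OF int_h nonneg] by simp
      then have "AE y in lebesgue. y \<notin> I"
        using pos
      proof eventually_elim
        case (elim y)
        then show ?case using \<open>v \<noteq> 0\<close> by (auto simp: h_def pos_def_def indicator_def)
      qed
      then have "emeasure lebesgue I = 0"
        by (metis AE_iff_null_sets emeasure_notin_sets null_setsD1)
      then show False using I by (simp add: measure_def)
    qed
    then show ?thesis using integral_nonneg_AE[OF nonneg] by simp
  qed
  ultimately show "0 < Re (quad_form (matrix_average I G) v)"
    using I by (simp add: zero_less_mult_iff)
qed

lemma mat_inv_sqrt_properties:
  assumes "pos_def A"
  shows "hermitian (mat_inv_sqrt A)" and "mat_inv_sqrt A ** mat_inv_sqrt A = matrix_inv A"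
  using mat_sqrt_properties[OF pos_def_imp_pos_semidef[OF pos_def_matrix_inv[OF assms]]]
  by (auto simp: mat_inv_sqrt_def pos_semidef_def)

text \<open>Write \<open>V\<close> for the inverse square root of the average \<open>m\<close> of \<open>W\<^sup>-\<^sup>1\<close>. The squared norm \<open>h y\<close> of
  \<open>V ** W\<^sup>-\<^sup>1\<^sup>/\<^sup>2 (y)\<close> is \<open>trace (V ** V ** W\<^sup>-\<^sup>1 (y))\<close>, whose average over \<open>I\<close> is
  \<open>trace (V ** V ** m) = trace (mat 1) = CARD('n)\<close>. By the inequality of arithmetic and geometric means,
  \<open>|V W\<^sup>-\<^sup>1\<^sup>/\<^sup>2 f| \<le> (t h + |f|\<^sup>2 / t) / 2\<close> for every \<open>t > 0\<close>. Integrating with \<open>t = l / CARD('n)\<close> gives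
  \<open>l |I| < l |I| / 2 + CARD('n) / (2 l) \<integral>\<^sub>I |f|\<^sup>2\<close>. For nonnegative integrals the
  almost everywhere bound by an integrable majorant is all that this comparison uses.\<close>
lemma emeasure_le_of_average_gt:
  fixes W :: "real ^ 'd \<Rightarrow> complex ^ 'n ^ 'n" and f :: "real ^ 'd \<Rightarrow> complex ^ 'n"
  assumes I: "I \<in> lmeasurable" "0 < measure lebesgue I"
    and int: "\<And>i j. set_integrable lebesgue I (\<lambda>x. matrix_inv (W x) $ i $ j)"
    and pos: "AE x in lebesgue. pos_def (W x)"
    and f: "in_L2 f" and l: "0 < l"
    and gt: "ennreal l < (\<integral>\<^sup>+y\<in>I. ennreal (norm ((mat_inv_sqrt (matrix_average I (\<lambda>z. matrix_inv (W z)))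
              ** mat_inv_sqrt (W y)) *v f y)) \<partial>lebesgue) / emeasure lebesgue I"
  shows "emeasure lebesgue I \<le> (\<integral>\<^sup>+y\<in>I. ennreal (CARD('n) / l\<^sup>2 * (norm (f y))\<^sup>2) \<partial>lebesgue)"
proof -
  define m where "m = matrix_average I (\<lambda>z. matrix_inv (W z))"
  define V where "V = mat_inv_sqrt m"
  define S where "S y = mat_inv_sqrt (W y)" for y
  define h where "h y = Re (trace ((V ** V) ** matrix_inv (W y)))" for y
  define n where "n = real CARD('n)"
  \<comment> \<open>The weight for which the term with \<open>h\<close> integrates to exactly half of \<open>l |I|\<close>, so that it can be absorbed.\<close>
  define t where "t = l / n"
  define \<mu> where "\<mu> = measure lebesgue I"
  define F where "F = (LINT y|lebesgue. indicator I y * (norm (f y))\<^sup>2)"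
  have n: "0 < n" and t: "0 < t" using l by (simp_all add: n_def t_def)
  have em: "emeasure lebesgue I = ennreal \<mu>"
    using I by (simp add: \<mu>_def emeasure_eq_measure2 fmeasurableD)
  have \<mu>: "0 < \<mu>" using I by (simp add: \<mu>_def)
  have m: "pos_def m"
    unfolding m_def using I(2) int pos
    by (intro pos_def_matrix_average) (auto elim: eventually_mono intro: pos_def_matrix_inv)
  have VV: "V ** V ** m = mat 1"
    using mat_inv_sqrt_properties(2)[OF m] invertible_matrix_inv[OF pos_def_invertible[OF m]] by (simp add: V_def)
  have tr: "set_integrable lebesgue I (\<lambda>y. trace ((V ** V) ** matrix_inv (W y)))"
    "(LINT y:I|lebesgue. trace ((V ** V) ** matrix_inv (W y))) = complex_of_real (\<mu> * n)"
    using set_integral_trace[OF int, of "V ** V"] I(2) VV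
    by (simp_all add: \<mu>_def m_def[symmetric] trace_I n_def)
  have h_eq: "indicator I y * h y = Re (indicator I y *\<^sub>R trace ((V ** V) ** matrix_inv (W y)))" for y
    by (simp add: h_def)
  have int_h: "integrable lebesgue (\<lambda>y. indicator I y * h y)"
    using tr(1) unfolding h_eq set_integrable_def by (rule integrable_Re)
  have integral_h: "(LINT y|lebesgue. indicator I y * h y) = \<mu> * n"
    using tr unfolding h_eq set_integrable_def set_lebesgue_integral_def
    by (subst Bochner_Integration.integral_Re) simp_all
  have int_f: "integrable lebesgue (\<lambda>y. indicator I y * (norm (f y))\<^sup>2)"
    using f I(1) integrable_mult_indicator[of I lebesgue "\<lambda>y. (norm (f y))\<^sup>2"]
    by (simp add: in_L2_def fmeasurableD)
  have bound: "AE y in lebesgue. 0 \<le> t * h y + (norm (f y))\<^sup>2 / t \<and>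
      norm ((V ** S y) *v f y) \<le> (t * h y + (norm (f y))\<^sup>2 / t) / 2"
    using pos
  proof eventually_elim
    case (elim y)
    have "h y = (norm (V ** S y))\<^sup>2"
      using norm_hermitian_mult_power2_eq_trace[OF mat_inv_sqrt_properties(1)[OF m] mat_inv_sqrt_properties(1)[OF elim]]
        mat_inv_sqrt_properties(2)[OF elim]
      by (simp add: h_def V_def S_def)
    moreover have "2 * (norm (V ** S y) * norm (f y)) \<le> t * (norm (V ** S y))\<^sup>2 + (norm (f y))\<^sup>2 / t"
    proof -
      have "0 \<le> (t * norm (V ** S y) - norm (f y))\<^sup>2 / t" using t by simp
      also have "\<dots> = t * (norm (V ** S y))\<^sup>2 + (norm (f y))\<^sup>2 / t - 2 * (norm (V ** S y) * norm (f y))"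
        using t by (simp add: power2_eq_square field_simps)
      finally show ?thesis by simp
    qed
    ultimately show ?case
      using norm_matrix_vector_mult_le[of "V ** S y" "f y"] t by auto
  qed
  have "(\<integral>\<^sup>+y\<in>I. ennreal (norm ((V ** S y) *v f y)) \<partial>lebesgue)
      \<le> (\<integral>\<^sup>+y. ennreal ((t * (indicator I y * h y) + (indicator I y * (norm (f y))\<^sup>2) / t) / 2) \<partial>lebesgue)"
  proof (rule nn_integral_mono_AE, use bound in eventually_elim)
    case (elim y)
    then show ?case by (auto simp: indicator_def intro: ennreal_leI)
  qed
  also have "\<dots> = ennreal ((t * (\<mu> * n) + F / t) / 2)"
  proof -
    have "AE y in lebesgue. 0 \<le> (t * (indicator I y * h y) + (indicator I y * (norm (f y))\<^sup>2) / t) / 2"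
      using bound
    proof eventually_elim
      case (elim y)
      then show ?case by (auto simp: indicator_def)
    qed
    then show ?thesis
      using int_h int_f by (subst nn_integral_eq_integral) (auto simp: integral_h F_def)
  qed
  finally have upper: "(\<integral>\<^sup>+y\<in>I. ennreal (norm ((V ** S y) *v f y)) \<partial>lebesgue)
      \<le> ennreal ((t * (\<mu> * n) + F / t) / 2)" .
  have F: "0 \<le> F" unfolding F_def by simp
  have "ennreal l < ennreal ((t * (\<mu> * n) + F / t) / 2) / ennreal \<mu>"
    using gt upper unfolding em V_def S_def m_def
    by (metis (no_types, lifting) divide_right_mono_ennreal order_less_le_trans)
  also have "\<dots> = ennreal ((t * (\<mu> * n) + F / t) / 2 / \<mu>)"
    using F t n \<mu> by (intro divide_ennreal) auto
  finally have less: "l < (t * (\<mu> * n) + F / t) / 2 / \<mu>"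
    using l by (simp add: ennreal_less_iff)
  have less_half_imp: "x < y" if "x < (x + y) / 2" for x y :: real
    using that by simp
  from less have "l * \<mu> < (l * \<mu> + F * n / l) / 2"
    using \<mu> n l by (simp add: t_def field_simps)
  then have "l * \<mu> < F * n / l"
    using less_half_imp by blast
  then have "\<mu> \<le> n / l\<^sup>2 * F"
    using l by (simp add: field_simps power2_eq_square)
  then have "emeasure lebesgue I \<le> ennreal (n / l\<^sup>2 * F)"
    unfolding em by (rule ennreal_leI)
  also have "\<dots> = (\<integral>\<^sup>+y. ennreal (n / l\<^sup>2 * (indicator I y * (norm (f y))\<^sup>2)) \<partial>lebesgue)"
    unfolding F_def using int_f n by (subst nn_integral_eq_integral) auto
  also have "\<dots> = (\<integral>\<^sup>+y\<in>I. ennreal (n / l\<^sup>2 * (norm (f y))\<^sup>2) \<partial>lebesgue)"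
    by (intro nn_integral_cong) (auto simp: indicator_def)
  finally show ?thesis by (simp add: n_def)
qed

section \<open>Nested families of sets and dyadic cubes\<close>

text \<open>The maximal members of a finite nested family are disjoint and have the same union, so the estimates
  for them can be added.\<close>
lemma emeasure_Union_nested_le_finite:
  assumes fin: "finite F" and sets: "F \<subseteq> sets M"
    and nested: "\<And>P Q. P \<in> F \<Longrightarrow> Q \<in> F \<Longrightarrow> P \<inter> Q = {} \<or> P \<subseteq> Q \<or> Q \<subseteq> P"
    and g: "g \<in> borel_measurable M"
    and le: "\<And>Q. Q \<in> F \<Longrightarrow> emeasure M Q \<le> (\<integral>\<^sup>+x\<in>Q. g x \<partial>M)"
  shows "emeasure M (\<Union>F) \<le> (\<integral>\<^sup>+x. g x \<partial>M)"
proof -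
  define G where "G = {Q \<in> F. \<forall>P\<in>F. Q \<subseteq> P \<longrightarrow> P = Q}"
  have G: "finite G" "G \<subseteq> F" "G \<subseteq> sets M" using fin sets by (auto simp: G_def)
  have "\<Union>F \<subseteq> \<Union>G"
  proof
    fix x assume "x \<in> \<Union>F"
    then obtain P where P: "P \<in> F" "x \<in> P" by blast
    then obtain Q where "Q \<in> F" "P \<subseteq> Q" "\<forall>R\<in>F. Q \<subseteq> R \<longrightarrow> Q = R"
      using finite_has_maximal2[OF fin P(1)] by blast
    then show "x \<in> \<Union>G" using P by (auto simp: G_def)
  qed
  then have "emeasure M (\<Union>F) \<le> emeasure M (\<Union>G)"
    using G by (intro emeasure_mono) auto
  also have "\<dots> \<le> (\<Sum>Q\<in>G. emeasure M Q)"
    using emeasure_subadditive_finite[of G "\<lambda>Q. Q" M] G by auto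
  also have "\<dots> \<le> (\<Sum>Q\<in>G. emeasure (density M g) Q)"
  proof (rule sum_mono)
    fix Q assume "Q \<in> G"
    then have "Q \<in> F" "Q \<in> sets M" using G by auto
    then show "emeasure M Q \<le> emeasure (density M g) Q"
      using le[of Q] by (simp only: emeasure_density[OF g])
  qed
  also have "\<dots> = emeasure (density M g) (\<Union>G)"
  proof -
    have "disjoint_family_on (\<lambda>Q. Q) G"
      unfolding disjoint_family_on_def
    proof (intro ballI impI)
      fix P Q assume "P \<in> G" "Q \<in> G" "P \<noteq> Q"
      then show "P \<inter> Q = {}" using nested[of P Q] by (auto simp: G_def)
    qed
    then show ?thesis using sum_emeasure[of "\<lambda>Q. Q" G "density M g"] G by auto
  qed
  also have "\<dots> \<le> emeasure (density M g) (space (density M g))"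
    by (rule emeasure_space)
  also have "\<dots> = (\<integral>\<^sup>+x. g x \<partial>M)"
    using g by (simp add: emeasure_density cong: nn_integral_cong)
  finally show ?thesis .
qed

text \<open>Exhausting the union by finite subfamilies reduces the countable case to the finite one; an infinite
  nested family may have no maximal members at all.\<close>
lemma emeasure_Union_nested_le:
  assumes cnt: "countable F" and sets: "F \<subseteq> sets M"
    and nested: "\<And>P Q. P \<in> F \<Longrightarrow> Q \<in> F \<Longrightarrow> P \<inter> Q = {} \<or> P \<subseteq> Q \<or> Q \<subseteq> P"
    and g: "g \<in> borel_measurable M"
    and le: "\<And>Q. Q \<in> F \<Longrightarrow> emeasure M Q \<le> (\<integral>\<^sup>+x\<in>Q. g x \<partial>M)"
  shows "emeasure M (\<Union>F) \<le> (\<integral>\<^sup>+x. g x \<partial>M)"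
proof (cases "F = {}")
  case False
  define A where "A n = \<Union>(from_nat_into F ` {..n})" for n
  have sub: "from_nat_into F ` {..n} \<subseteq> F" for n
    using from_nat_into[OF False] by blast
  have "(\<Union>n. A n) = \<Union>(range (from_nat_into F))"
    by (auto simp: A_def)
  also have "\<dots> = \<Union>F"
    using range_from_nat_into[OF False cnt] by simp
  finally have "emeasure M (\<Union>F) = emeasure M (\<Union>n. A n)" by simp
  also have "\<dots> = (SUP n. emeasure M (A n))"
  proof (rule SUP_emeasure_incseq[symmetric])
    have "A n \<in> sets M" for n
      unfolding A_def using sub[of n] sets by (intro sets.finite_Union) auto
    then show "range A \<subseteq> sets M" by blast
    show "incseq A" by (force simp: incseq_def A_def)
  qed
  also have "\<dots> \<le> (\<integral>\<^sup>+x. g x \<partial>M)"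
  proof (rule SUP_least)
    fix n
    show "emeasure M (A n) \<le> (\<integral>\<^sup>+x. g x \<partial>M)"
      unfolding A_def
    proof (rule emeasure_Union_nested_le_finite)
      show "from_nat_into F ` {..n} \<subseteq> sets M" using sub sets by blast
      show "P \<inter> Q = {} \<or> P \<subseteq> Q \<or> Q \<subseteq> P"
        if "P \<in> from_nat_into F ` {..n}" "Q \<in> from_nat_into F ` {..n}" for P Q
        using nested that sub by blast
      show "emeasure M Q \<le> (\<integral>\<^sup>+x\<in>Q. g x \<partial>M)" if "Q \<in> from_nat_into F ` {..n}" for Q
        using le that sub by blast
    qed (use g in auto)
  qed
  finally show ?thesis .
qed simp

lemma half_open_cube_between:
  "box a (a + (\<chi> i. s)) \<subseteq> half_open_cube a s" "half_open_cube a s \<subseteq> cbox a (a + (\<chi> i. s))"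
proof -
  show "box a (a + (\<chi> i. s)) \<subseteq> half_open_cube a s"
    unfolding half_open_cube_def by (auto simp: mem_box_cart intro: less_imp_le)
  show "half_open_cube a s \<subseteq> cbox a (a + (\<chi> i. s))"
  proof
    fix x assume "x \<in> half_open_cube a s"
    then have "a $ i \<le> x $ i" "x $ i < a $ i + s" for i
      by (auto simp: half_open_cube_def)
    then have "a $ i \<le> x $ i \<and> x $ i \<le> a $ i + s" for i
      by (simp add: less_imp_le)
    then show "x \<in> cbox a (a + (\<chi> i. s))"
      by (simp add: mem_box_cart)
  qed
qed

lemma half_open_cube_nonempty_interior:
  assumes "0 < s" shows "interior (half_open_cube a s) \<noteq> {}"
proof -
  have "box a (a + (\<chi> i. s)) \<subseteq> interior (half_open_cube a s)"
    by (rule interior_maximal[OF half_open_cube_between(1) open_box])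
  moreover have "a + (\<chi> i. s / 2) \<in> box a (a + (\<chi> i. s))"
    using assms by (simp add: mem_box_cart)
  ultimately show ?thesis by blast
qed

lemma half_open_cube_lmeasurable: "half_open_cube a s \<in> lmeasurable"
proof (rule measurable_convex)
  have "half_open_cube a s = (\<Inter>i. {x. a $ i \<le> x $ i} \<inter> {x. x $ i < a $ i + s})"
    by (auto simp: half_open_cube_def)
  moreover have "convex {x. a $ i \<le> x $ i}" "convex {x. x $ i < a $ i + s}" for i
    using convex_halfspace_ge[of "a $ i" "axis i (1 :: real)"]
      convex_halfspace_lt[of "axis i (1 :: real)" "a $ i + s"]
    by (simp_all add: inner_axis')
  ultimately show "convex (half_open_cube a s)"
    by (simp only:) (intro convex_INT convex_Int)
  show "bounded (half_open_cube a s)"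
    using bounded_subset[OF bounded_cbox] half_open_cube_between by blast
qed

lemma measure_half_open_cube_pos:
  assumes "0 < s" shows "0 < measure lebesgue (half_open_cube a s)"
proof -
  have "\<not> negligible (half_open_cube a s)"
    using half_open_cube_nonempty_interior[OF assms] open_not_negligible negligible_subset
      interior_subset open_interior by metis
  then show ?thesis
    using half_open_cube_lmeasurable negligible_iff_measure zero_less_measure_iff by blast
qed

lemma dyadic_grid_cube:
  assumes "dyadic_grid D" and "Q \<in> D"
  obtains a and k :: int where "Q = half_open_cube a (2 powi k)"
proof -
  have "\<forall>Q\<in>D. \<exists>a. \<exists>k::int. Q = half_open_cube a (2 powi k)"
    using assms(1) unfolding dyadic_grid_def by (elim conjE)
  then show thesis using assms(2) that by blast
qed

text \<open>The cubes of one side length are disjoint with nonempty interiors, so each generation is countable.\<close>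
lemma countable_dyadic_grid:
  assumes "dyadic_grid D" shows "countable D"
proof -
  define level where "level k = {Q\<in>D. \<exists>a. Q = half_open_cube a (2 powi k)}" for k :: int
  have "countable (level k)" for k
  proof (rule countable_disjoint_nonempty_interior_subsets)
    show "disjoint (level k)"
      using assms by (simp add: dyadic_grid_def partition_on_def level_def)
    show "S = {}" if "S \<in> level k" "interior S = {}" for S
      using that half_open_cube_nonempty_interior[of "2 powi k"] by (auto simp: level_def)
  qed
  then have "countable (\<Union>k. level k)" by simp
  moreover have "D \<subseteq> (\<Union>k. level k)"
  proof
    fix Q assume Q: "Q \<in> D"
    then obtain a and k :: int where "Q = half_open_cube a (2 powi k)"
      using dyadic_grid_cube[OF assms] by metis
    then have "Q \<in> level k" using Q unfolding level_def by auto
    then show "Q \<in> (\<Union>k. level k)" by (rule UN_I[OF UNIV_I])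
  qed
  ultimately show ?thesis by (rule countable_subset[rotated])
qed

section \<open>The weak type estimate\<close>

theorem proposition4p6:
  fixes W :: "real ^ 'd \<Rightarrow> complex ^ 'n ^ 'n"
    and D :: "(real ^ 'd) set set"
  assumes "matrix_weight W"
    and "locally_integrable_matrix (\<lambda>x. matrix_inv (W x))"
    and "dyadic_grid D"
  shows "\<exists>C::real. \<forall>f :: real ^ 'd \<Rightarrow> complex ^ 'n. \<forall>l::real. in_L2 f \<longrightarrow> 0 < l \<longrightarrow>
           {x. maximal_fun D W f x > ennreal l} \<in> sets lebesgue \<and>
           emeasure lebesgue {x. maximal_fun D W f x > ennreal l}
             \<le> ennreal (C / l\<^sup>2 * (L2_norm_fun f)\<^sup>2)"
proof (intro exI[of _ "real CARD('n)"] allI impI)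
  fix f :: "real ^ 'd \<Rightarrow> complex ^ 'n" and l :: real
  assume f: "in_L2 f" and l: "0 < l"
  \<comment> \<open>The superlevel set is the union of the cubes whose average exceeds \<open>l\<close>, as any such cube lies in it entirely.\<close>
  define B where "B = {I \<in> D. ennreal l < (\<integral>\<^sup>+y\<in>I. ennreal (norm ((mat_inv_sqrt
      (matrix_average I (\<lambda>z. matrix_inv (W z))) ** mat_inv_sqrt (W y)) *v f y)) \<partial>lebesgue)
        / emeasure lebesgue I}"
  have level: "{x. maximal_fun D W f x > ennreal l} = \<Union>B"
    by (auto simp: maximal_fun_def less_SUP_iff B_def)
  have cube: "\<exists>a s. 0 < s \<and> Q = half_open_cube a s" if "Q \<in> D" for Q
  proof -
    obtain a and k :: int where "Q = half_open_cube a (2 powi k)"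
      using dyadic_grid_cube[OF assms(3) \<open>Q \<in> D\<close>] .
    then show ?thesis by (intro exI[of _ a] exI[of _ "2 powi k"]) simp
  qed
  have "countable B"
    using countable_dyadic_grid[OF assms(3)] by (rule countable_subset[rotated]) (auto simp: B_def)
  have B_sets: "B \<subseteq> sets lebesgue"
  proof
    fix Q assume "Q \<in> B"
    then obtain a s where "Q = half_open_cube a s" using cube unfolding B_def by blast
    then show "Q \<in> sets lebesgue" by (simp only: fmeasurableD[OF half_open_cube_lmeasurable])
  qed
  have small: "emeasure lebesgue I \<le> (\<integral>\<^sup>+y\<in>I. ennreal (CARD('n) / l\<^sup>2 * (norm (f y))\<^sup>2) \<partial>lebesgue)"
    if I: "I \<in> B" for I
  proof -
    obtain a s where s: "0 < s" "I = half_open_cube a s"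
      using cube[of I] I unfolding B_def by blast
    show ?thesis
    proof (rule emeasure_le_of_average_gt[where W = W])
      show "I \<in> lmeasurable" "0 < measure lebesgue I"
        using s half_open_cube_lmeasurable measure_half_open_cube_pos by auto
      show "set_integrable lebesgue I (\<lambda>x. matrix_inv (W x) $ i $ j)" for i j
      proof (rule set_integrable_subset)
        show "set_integrable lebesgue (cbox a (a + (\<chi> i. s))) (\<lambda>x. matrix_inv (W x) $ i $ j)"
          using assms(2) compact_cbox by (auto simp: locally_integrable_matrix_def)
        show "I \<in> sets lebesgue" "I \<subseteq> cbox a (a + (\<chi> i. s))"
          unfolding s(2) by (rule fmeasurableD[OF half_open_cube_lmeasurable] half_open_cube_between)+
      qed
      show "AE x in lebesgue. pos_def (W x)"
        using assms(1) by (simp add: matrix_weight_def)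
    qed (use I f l in \<open>auto simp: B_def\<close>)
  qed
  have int_f: "integrable lebesgue (\<lambda>y. (norm (f y))\<^sup>2)"
    using f by (simp add: in_L2_def)
  have "emeasure lebesgue (\<Union>B) \<le> (\<integral>\<^sup>+y. ennreal (CARD('n) / l\<^sup>2 * (norm (f y))\<^sup>2) \<partial>lebesgue)"
  proof (rule emeasure_Union_nested_le[OF \<open>countable B\<close> B_sets _ _ small])
    show "P \<inter> Q = {} \<or> P \<subseteq> Q \<or> Q \<subseteq> P" if "P \<in> B" "Q \<in> B" for P Q
      using assms(3) that by (simp add: dyadic_grid_def B_def)
    show "(\<lambda>y. ennreal (CARD('n) / l\<^sup>2 * (norm (f y))\<^sup>2)) \<in> borel_measurable lebesgue"
      using borel_measurable_integrable[OF int_f] by measurable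
  qed
  also have "\<dots> = ennreal (CARD('n) / l\<^sup>2 * (L2_norm_fun f)\<^sup>2)"
    unfolding L2_norm_fun_def
    by (subst nn_integral_eq_integral) (simp_all add: int_f)
  finally show "{x. maximal_fun D W f x > ennreal l} \<in> sets lebesgue \<and>
      emeasure lebesgue {x. maximal_fun D W f x > ennreal l}
        \<le> ennreal (real CARD('n) / l\<^sup>2 * (L2_norm_fun f)\<^sup>2)"
    unfolding level using sets.countable_Union[OF \<open>countable B\<close> B_sets] by simp
qed

end
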